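(* Let $|\phi\rangle=A|20\rangle+B|11\rangle+C|02\rangle$ be a normalized two-photon two-mode state. For $m\ge1$ and $M\in\mathrm{U}(2+m)$ with associated linear optical passive transformation $U$ on $2+m$ modes, let $|\phi_0^M\rangle$ be the (unnormalized) two-mode state of modes $1,2$ obtained by applying $U$ to $|11\rangle|0\cdots0\rangle$ and projecting all $m$ ancillary modes $3,\dots,m+2$ onto the vacuum. Let $\mathcal{P}^{(m)}_{\max}(\phi)$ be the supremum of $\langle\phi_0^M|\phi_0^M\rangle$ over all $M\in\mathrm{U}(2+m)$ such that $|\phi_0^M\rangle$ is a nonzero scalar multiple of $|\phi\rangle$. Then using several ancillary modes gives no improvement over a single one: for every $m\ge1$, $\mathcal{P}^{(m)}_{\max}(\phi)\le\mathcal{P}^{(1)}_{\max}(\phi)$.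
   Context: Consider $N$ bosonic modes with annihilation and creation operators $a_i,a_i^\dagger$, $[a_i,a_j^\dagger]=\delta_{ij}\mathbb{I}$, $[a_i,a_j]=0$, acting on the $N$-mode Fock space with vacuum $|0\cdots0\rangle$. The number states are $|n_1\cdots n_N\rangle=\prod_i (a_i^\dagger)^{n_i}/\sqrt{n_i!}\,|0\cdots 0\rangle$. The linear optical passive (LOP) transformation associated with $M\in\mathrm{U}(N)$ is the unitary operator $U$ on Fock space with $U^\dagger a_iU=\sum_j M_{ij}a_j$ and $U|0\cdots0\rangle=|0\cdots0\rangle$. In particular, with $N=2+m$, $U|11\rangle|0\cdots0\rangle=\sum_{p,q=1}^{N} M_{p1}M_{q2}\,a_p^\dagger a_q^\dagger|0\cdots0\rangle$. The quantity $\langle\phi_0^M|\phi_0^M\rangle$ is the probability of success of the post-selection on the vacuum in all ancillary modes. *)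

theory Defs
  imports "HOL-Analysis.Infinite_Sum" "HOL-Library.Extended_Real"
    "Jordan_Normal_Form.Schur_Decomposition"
begin

text \<open>
  Modes are numbered from 0. An occupation pattern of \<open>N\<close> modes is a function that vanishes from
  index \<open>N\<close> on, so a pattern of the first two modes, read as a pattern of \<open>N\<close> modes, has
  vacuum in all the others. A vector of Fock space is given by its amplitudes
  \<open>\<psi> n = \<langle>n|\<psi>\<rangle>\<close> in the orthonormal basis of number states.
\<close>

type_synonym occupation = "nat \<Rightarrow> nat"
type_synonym fock_vec = "occupation \<Rightarrow> complex"

definition occupations :: "nat \<Rightarrow> occupation set" where
  "occupations N = {n. \<forall>i\<ge>N. n i = 0}"

definition fock :: "nat \<Rightarrow> fock_vec set" where
  "fock N = {\<psi>. (\<forall>n. n \<notin> occupations N \<longrightarrow> \<psi> n = 0) \<and> (\<lambda>n. (cmod (\<psi> n))\<^sup>2) summable_on UNIV}"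

definition fock_inner :: "fock_vec \<Rightarrow> fock_vec \<Rightarrow> complex" where
  "fock_inner \<psi> \<chi> = (\<Sum>\<^sub>\<infinity>n. cnj (\<psi> n) * \<chi> n)"

definition ket_occ :: "occupation \<Rightarrow> fock_vec" where
  "ket_occ n = (\<lambda>k. if k = n then 1 else 0)"

definition ket :: "nat list \<Rightarrow> fock_vec" where
  "ket xs = ket_occ (\<lambda>i. if i < length xs then xs ! i else 0)"

text \<open>
  The ladder operators act on arbitrary amplitude functions; as operators on \<open>fock N\<close> they are
  unbounded, so their domains are made explicit where they are used.
\<close>

definition annihilate :: "nat \<Rightarrow> fock_vec \<Rightarrow> fock_vec" where
  "annihilate i \<psi> = (\<lambda>n. complex_of_real (sqrt (real (Suc (n i)))) * \<psi> (n(i := Suc (n i))))"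

definition create :: "nat \<Rightarrow> fock_vec \<Rightarrow> fock_vec" where
  "create i \<psi> = (\<lambda>n. complex_of_real (sqrt (real (n i))) * \<psi> (n(i := n i - 1)))"

lemma commutator_annihilate_create:
  "annihilate i (create j \<psi>) n - create j (annihilate i \<psi>) n = (if i = j then \<psi> n else 0)"
proof (cases "i = j")
  case True
  have s: "complex_of_real (sqrt (real k)) * (complex_of_real (sqrt (real k)) * z) = of_nat k * z"
    for k z
    by (simp flip: of_real_mult mult.assoc)
  have "annihilate i (create j \<psi>) n = of_nat (Suc (n j)) * \<psi> n"
    using True s[of "Suc (n j)" "\<psi> n"] by (simp add: annihilate_def create_def)
  moreover have "create j (annihilate i \<psi>) n = of_nat (n j) * \<psi> n"
  proof (cases "n j")
    case (Suc k)
    then have "n(j := Suc k) = n"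
      by (simp add: fun_upd_idem)
    with Suc True s[of "Suc k" "\<psi> n"] show ?thesis
      by (simp add: annihilate_def create_def)
  qed (simp add: create_def)
  ultimately show ?thesis
    using True by (simp add: algebra_simps)
qed (auto simp: annihilate_def create_def fun_upd_twist)

lemma commutator_annihilate: "annihilate i (annihilate j \<psi>) = annihilate j (annihilate i \<psi>)"
  by (cases "i = j") (auto simp: annihilate_def fun_upd_twist algebra_simps)

lemma create_ket_occ:
  "create i (ket_occ n) =
     (\<lambda>k. complex_of_real (sqrt (real (Suc (n i)))) * ket_occ (n(i := Suc (n i))) k)"
proof
  fix k
  have "k(i := k i - 1) = n \<longleftrightarrow> k = n(i := Suc (n i))" if "k i > 0"
    using that by (auto simp: fun_eq_iff)
  then show "create i (ket_occ n) k =
      complex_of_real (sqrt (real (Suc (n i)))) * ket_occ (n(i := Suc (n i))) k"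
    by (cases "k i > 0") (auto simp: create_def ket_occ_def)
qed

definition fock_unitary :: "nat \<Rightarrow> (fock_vec \<Rightarrow> fock_vec) \<Rightarrow> bool" where
  "fock_unitary N U \<longleftrightarrow>
     bij_betw U (fock N) (fock N) \<and>
     (\<forall>\<psi>\<in>fock N. \<forall>\<chi>\<in>fock N. \<forall>c d.
        U (\<lambda>n. c * \<psi> n + d * \<chi> n) = (\<lambda>n. c * U \<psi> n + d * U \<chi> n)) \<and>
     (\<forall>\<psi>\<in>fock N. \<forall>\<chi>\<in>fock N. fock_inner (U \<psi>) (U \<chi>) = fock_inner \<psi> \<chi>)"

definition ladder_domain :: "nat \<Rightarrow> fock_vec set" where
  "ladder_domain N = {\<psi> \<in> fock N. \<forall>j<N. annihilate j \<psi> \<in> fock N}"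

definition unitary_group :: "nat \<Rightarrow> complex mat set" where
  "unitary_group N = {M \<in> carrier_mat N N. mat_adjoint M * M = 1\<^sub>m N \<and> M * mat_adjoint M = 1\<^sub>m N}"

text \<open>
  \<open>U\<close> is the passive transformation of \<open>M\<close>: \<open>U\<^sup>\<dagger> a\<^sub>i U = \<Sum>\<^sub>j M\<^sub>i\<^sub>j a\<^sub>j\<close> on the
  common domain of the \<open>a\<^sub>j\<close>, and \<open>U\<close> fixes the vacuum. The adjoint of the unitary \<open>U\<close> is its
  inverse on \<open>fock N\<close>.
\<close>

definition lop :: "nat \<Rightarrow> complex mat \<Rightarrow> (fock_vec \<Rightarrow> fock_vec) \<Rightarrow> bool" where
  "lop N M U \<longleftrightarrow>
     fock_unitary N U \<and>
     U (ket (replicate N 0)) = ket (replicate N 0) \<and>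
     (\<forall>\<psi>\<in>ladder_domain N.
        U \<psi> \<in> ladder_domain N \<and>
        (\<forall>i<N. inv_into (fock N) U (annihilate i (U \<psi>)) =
                (\<lambda>n. \<Sum>j<N. M $$ (i, j) * annihilate j \<psi> n)))"

text \<open>
  Partial inner product with the vacuum of all modes other than the first \<open>N\<close>.
\<close>

definition project_vacuum :: "nat \<Rightarrow> fock_vec \<Rightarrow> fock_vec" where
  "project_vacuum N \<psi> = (\<lambda>n. if n \<in> occupations N then \<psi> n else 0)"

definition postselected :: "nat \<Rightarrow> (fock_vec \<Rightarrow> fock_vec) \<Rightarrow> fock_vec" where
  "postselected m U = project_vacuum 2 (U (ket ([1, 1] @ replicate m 0)))"

definition success_prob :: "nat \<Rightarrow> (fock_vec \<Rightarrow> fock_vec) \<Rightarrow> real" where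
  "success_prob m U = Re (fock_inner (postselected m U) (postselected m U))"

definition max_success_prob :: "nat \<Rightarrow> fock_vec \<Rightarrow> ereal" where
  "max_success_prob m \<phi> =
     Sup {ereal (success_prob m U) | M U.
            M \<in> unitary_group (2 + m) \<and> lop (2 + m) M U \<and>
            (\<exists>c. c \<noteq> 0 \<and> postselected m U = (\<lambda>n. c * \<phi> n))}"

end

theory Submission
  imports Defs "HOL-Analysis.Convex"
begin

text \<open>
  The post-selected state depends only on the upper left \<open>2 \<times> 2\<close> block \<open>K\<close> of \<open>M\<close>, through products of
  one entry from each of its columns. Replacing the contraction \<open>K\<close> by \<open>K / \<parallel>K\<parallel>\<close> therefore only
  multiplies the state by \<open>1 / \<parallel>K\<parallel>\<^sup>2 \<ge> 1\<close>. The new block has norm 1, so \<open>1 - K\<^sup>\<dagger> K\<close> has rank at most one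
  and a single further mode suffices to extend \<open>K\<close> to a unitary matrix.

  A passive transformation is determined by \<open>a\<^sub>i U = U (\<Sum>\<^sub>j M\<^sub>i\<^sub>j a\<^sub>j)\<close> and its action on the vacuum. It is
  isometric on each photon number sector by induction on the number of photons, since
  \<open>\<Sum>\<^sub>i \<langle>a\<^sub>i \<psi> | a\<^sub>i \<chi>\<rangle>\<close> is invariant under unitary rotations of the \<open>a\<^sub>i\<close> and equals the photon number
  times \<open>\<langle>\<psi> | \<chi>\<rangle>\<close>.
\<close>

section \<open>Occupation patterns\<close>

lemma zero_in_occupations [simp]: "(\<lambda>_. 0) \<in> occupations N"
  by (simp add: occupations_def)

lemma upd_in_occupations_iff: "i < N \<Longrightarrow> n(i := x) \<in> occupations N \<longleftrightarrow> n \<in> occupations N"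
  by (auto simp: occupations_def)

lemma sum_upd_Suc:
  fixes n :: occupation
  assumes "i < N"
  shows "(\<Sum>k<N. (n(i := Suc (n i))) k) = Suc (\<Sum>k<N. n k)"
proof -
  have "(\<Sum>k\<in>{..<N} - {i}. (n(i := Suc (n i))) k) = (\<Sum>k\<in>{..<N} - {i}. n k)"
    by (rule sum.cong) auto
  moreover have "(\<Sum>k<N. f k) = f i + (\<Sum>k\<in>{..<N} - {i}. f k)" for f :: occupation
    using assms by (intro sum.remove) auto
  ultimately show ?thesis by simp
qed

lemma occupations_cases [consumes 1, case_names vacuum raise]:
  assumes "n \<in> occupations N"
  obtains "n = (\<lambda>_. 0)"
    | i k where "i < N" "k \<in> occupations N" "n = k(i := Suc (k i))"
proof (cases "\<exists>i<N. n i > 0")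
  case True
  then obtain i where i: "i < N" "n i > 0" by blast
  show ?thesis
  proof (rule that(2)[of i "n(i := n i - 1)"])
    show "n = (n(i := n i - 1))(i := Suc ((n(i := n i - 1)) i))"
      using i by (auto simp: fun_eq_iff)
  qed (use i assms in \<open>auto simp: upd_in_occupations_iff\<close>)
next
  case False
  then have "n = (\<lambda>_. 0)"
    using assms by (intro ext) (simp add: occupations_def, metis not_le_imp_less)
  then show ?thesis by (rule that(1))
qed

lemma occupations_induct [consumes 1, case_names vacuum raise]:
  assumes "n \<in> occupations N"
    and "P (\<lambda>_. 0)"
    and "\<And>n i. n \<in> occupations N \<Longrightarrow> i < N \<Longrightarrow> P n \<Longrightarrow> P (n(i := Suc (n i)))"
  shows "P n"
  using assms(1)
proof (induction "\<Sum>k<N. n k" arbitrary: n rule: less_induct)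
  case less
  from less.prems show ?case
  proof (cases rule: occupations_cases)
    case vacuum
    with assms(2) show ?thesis by simp
  next
    case (raise i k)
    then have "(\<Sum>j<N. k j) < (\<Sum>j<N. n j)"
      using sum_upd_Suc[of i N k] by simp
    with raise less.hyps[of k] assms(3)[of k i] show ?thesis by simp
  qed
qed

text \<open>Indexes the number states with exactly \<open>d\<close> photons. Each sector is finite,
  so isometry can be proved there with finite sums before any question of convergence
  arises.\<close>

definition sector :: "nat \<Rightarrow> nat \<Rightarrow> occupation set" where
  "sector N d = {n \<in> occupations N. (\<Sum>i<N. n i) = d}"

lemma sector_0: "sector N 0 = {\<lambda>_. 0}"
proof -
  have "n = (\<lambda>_. 0)" if "n \<in> occupations N" "(\<Sum>i<N. n i) = 0" for n
    using that(1)
  proof (cases rule: occupations_cases)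
    case (raise i k)
    then show ?thesis using sum_upd_Suc[of i N k] that(2) by simp
  qed
  then show ?thesis by (auto simp: sector_def)
qed

lemma upd_Suc_in_sector:
  "i < N \<Longrightarrow> n \<in> sector N d \<Longrightarrow> n(i := Suc (n i)) \<in> sector N (Suc d)"
  using sum_upd_Suc[of i N n] by (simp add: sector_def upd_in_occupations_iff)

lemma upd_pred_in_sector:
  assumes "i < N" "n \<in> sector N (Suc d)" "n i > 0"
  shows "n(i := n i - 1) \<in> sector N d"
proof -
  let ?k = "n(i := n i - 1)"
  have "?k(i := Suc (?k i)) = n" using assms by (auto simp: fun_eq_iff)
  then show ?thesis
    using assms sum_upd_Suc[of i N ?k] by (simp add: sector_def upd_in_occupations_iff)
qed

lemma finite_sector: "finite (sector N d)"
proof (induction d)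
  case (Suc d)
  have "sector N (Suc d) \<subseteq> (\<Union>i<N. (\<lambda>n. n(i := Suc (n i))) ` sector N d)"
  proof
    fix n assume n: "n \<in> sector N (Suc d)"
    then have "n \<in> occupations N" by (simp add: sector_def)
    then show "n \<in> (\<Union>i<N. (\<lambda>n. n(i := Suc (n i))) ` sector N d)"
    proof (cases rule: occupations_cases)
      case vacuum
      with n show ?thesis by (simp add: sector_def)
    next
      case (raise i k)
      then have "k \<in> sector N d"
        using n sum_upd_Suc[of i N k] by (simp add: sector_def)
      with raise show ?thesis by blast
    qed
  qed
  then show ?case
    by (rule finite_subset) (simp add: Suc)
qed (simp add: sector_0)

text \<open>Raising mode \<open>i\<close> maps the \<open>d\<close>-photon patterns bijectively onto
  the patterns with \<open>d + 1\<close> photons and mode \<open>i\<close> occupied. The weight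
  \<open>n i\<close> vanishes on the rest.\<close>

lemma sum_sector_raise:
  fixes f :: "occupation \<Rightarrow> 'a::comm_semiring_1"
  assumes "i < N"
  shows "(\<Sum>n\<in>sector N d. of_nat (Suc (n i)) * f (n(i := Suc (n i)))) =
         (\<Sum>n\<in>sector N (Suc d). of_nat (n i) * f n)"
proof -
  have "(\<Sum>n\<in>sector N d. of_nat (Suc (n i)) * f (n(i := Suc (n i)))) =
        (\<Sum>n\<in>{n \<in> sector N (Suc d). n i > 0}. of_nat (n i) * f n)"
    by (rule sum.reindex_bij_witness[of _ "\<lambda>n. n(i := n i - 1)" "\<lambda>n. n(i := Suc (n i))"])
       (use assms in \<open>auto simp: upd_Suc_in_sector intro: upd_pred_in_sector[simplified]\<close>)
  also have "\<dots> = (\<Sum>n\<in>sector N (Suc d). of_nat (n i) * f n)"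
    by (rule sum.mono_neutral_left) (auto simp: finite_sector)
  finally show ?thesis .
qed

section \<open>Linear combinations of annihilation operators\<close>

definition rotated_annihilate :: "nat \<Rightarrow> complex mat \<Rightarrow> nat \<Rightarrow> fock_vec \<Rightarrow> fock_vec" where
  "rotated_annihilate N M i \<psi> = (\<lambda>n. \<Sum>j<N. M $$ (i, j) * annihilate j \<psi> n)"

text \<open>Inductions on patterns reduce a raised pattern this way: its amplitude is that of an
  annihilated vector at a pattern with one photon less.\<close>

lemma annihilate_raise:
  "\<psi> (n(i := Suc (n i))) = annihilate i \<psi> n / complex_of_real (sqrt (real (Suc (n i))))"
  by (simp add: annihilate_def del: of_nat_Suc)

lemma annihilate_lincomb:
  "annihilate i (\<lambda>n. c * \<psi> n + d * \<chi> n) = (\<lambda>n. c * annihilate i \<psi> n + d * annihilate i \<chi> n)"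
  by (simp add: annihilate_def algebra_simps)

lemma annihilate_sum:
  "annihilate i (\<lambda>n. \<Sum>j\<in>J. c j * \<psi> j n) = (\<lambda>n. \<Sum>j\<in>J. c j * annihilate i (\<psi> j) n)"
  by (simp add: annihilate_def sum_distrib_left algebra_simps)

lemma rotated_annihilate_lincomb:
  "rotated_annihilate N M i (\<lambda>n. c * \<psi> n + d * \<chi> n) =
     (\<lambda>n. c * rotated_annihilate N M i \<psi> n + d * rotated_annihilate N M i \<chi> n)"
  by (simp add: rotated_annihilate_def annihilate_lincomb sum_distrib_left
      sum.distrib algebra_simps)

lemma rotated_annihilate_commute:
  "rotated_annihilate N M i (rotated_annihilate N M' k \<psi>) =
   rotated_annihilate N M' k (rotated_annihilate N M i \<psi>)"
proof
  fix n
  have "rotated_annihilate N M i (rotated_annihilate N M' k \<psi>) n =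
      (\<Sum>j<N. \<Sum>l<N. M $$ (i, j) * (M' $$ (k, l) * annihilate j (annihilate l \<psi>) n))"
    by (simp add: rotated_annihilate_def annihilate_sum sum_distrib_left)
  also have "\<dots> = (\<Sum>l<N. \<Sum>j<N. M' $$ (k, l) * (M $$ (i, j) * annihilate l (annihilate j \<psi>) n))"
    by (subst sum.swap) (simp add: algebra_simps commutator_annihilate)
  also have "\<dots> = rotated_annihilate N M' k (rotated_annihilate N M i \<psi>) n"
    by (simp add: rotated_annihilate_def annihilate_sum sum_distrib_left)
  finally show "rotated_annihilate N M i (rotated_annihilate N M' k \<psi>) n =
      rotated_annihilate N M' k (rotated_annihilate N M i \<psi>) n" .
qed

section \<open>Monomials in commuting operators\<close>

fun monomial :: "(nat \<Rightarrow> 'a \<Rightarrow> 'a) \<Rightarrow> nat \<Rightarrow> occupation \<Rightarrow> 'a \<Rightarrow> 'a" where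
  "monomial c 0 n x = x"
| "monomial c (Suc K) n x = monomial c K n ((c K ^^ n K) x)"

lemma monomial_cong: "(\<And>i. i < K \<Longrightarrow> n i = n' i) \<Longrightarrow> monomial c K n x = monomial c K n' x"
  by (induction K arbitrary: x) auto

lemma funpow_commute:
  assumes "\<And>x. f (g x) = g (f x)"
  shows "f ((g ^^ k) x) = (g ^^ k) (f x)"
  by (induction k) (simp_all add: assms)

text \<open>Commutativity carries the additional factor \<open>c i\<close> past the powers of the
  higher modes, so that it acts first.\<close>

lemma monomial_raise:
  assumes commute: "\<And>i j x. c i (c j x) = c j (c i x)" and "i < K"
  shows "monomial c K (n(i := Suc (n i))) x = monomial c K n (c i x)"
  using assms(2)
proof (induction K arbitrary: x)
  case (Suc K)
  show ?case
  proof (cases "i = K")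
    case True
    have "monomial c K (n(K := Suc (n K))) y = monomial c K n y" for y
      by (rule monomial_cong) simp
    with True show ?thesis
      by (simp only: monomial.simps fun_upd_same funpow_Suc_right o_apply)
  next
    case False
    with Suc show ?thesis
      by (simp add: funpow_commute[of "c i" "c K"] commute)
  qed
qed simp

lemma monomial_vacuum: "monomial c K (\<lambda>_. 0) x = x"
  by (induction K arbitrary: x) auto

section \<open>Second quantization of a matrix\<close>

text \<open>
  Reads off \<open>\<langle>n|U\<psi>\<rangle> = \<langle>0|\<Prod>\<^sub>i a\<^sub>i\<^bsup>n\<^sub>i\<^esup> U|\<psi>\<rangle> / \<surd>(\<Prod>\<^sub>i n\<^sub>i!)\<close> with every \<open>a\<^sub>i\<close> moved to the right of \<open>U\<close>.
\<close>

definition second_quantize :: "nat \<Rightarrow> complex mat \<Rightarrow> fock_vec \<Rightarrow> fock_vec" where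
  "second_quantize N M \<psi> = (\<lambda>n. if n \<in> occupations N
     then monomial (rotated_annihilate N M) N n \<psi> (\<lambda>_. 0) /
       complex_of_real (sqrt (\<Prod>i<N. fact (n i)))
     else 0)"

lemma second_quantize_outside: "n \<notin> occupations N \<Longrightarrow> second_quantize N M \<psi> n = 0"
  by (simp add: second_quantize_def)

lemma second_quantize_vacuum: "second_quantize N M \<psi> (\<lambda>_. 0) = \<psi> (\<lambda>_. 0)"
  by (simp add: second_quantize_def monomial_vacuum)

lemma prod_fact_raise:
  fixes n :: occupation
  assumes "i < N"
  shows "(\<Prod>k<N. fact ((n(i := Suc (n i))) k) :: real) = real (Suc (n i)) * (\<Prod>k<N. fact (n k))"
proof -
  have "(\<Prod>k\<in>{..<N} - {i}. fact ((n(i := Suc (n i))) k) :: real) =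
      (\<Prod>k\<in>{..<N} - {i}. fact (n k))"
    by (rule prod.cong) auto
  moreover have "(\<Prod>k<N. f k) = f i * (\<Prod>k\<in>{..<N} - {i}. f k)" for f :: "nat \<Rightarrow> real"
    using assms by (intro prod.remove) auto
  ultimately show ?thesis by (simp add: algebra_simps)
qed

text \<open>The intertwining relation behind the definition of \<open>lop\<close>, valid here for
  every amplitude function. The root of \<open>Suc (n i)\<close> from the annihilation cancels the
  growth of the factorial in the normalization.\<close>

lemma annihilate_second_quantize:
  assumes "i < N"
  shows "annihilate i (second_quantize N M \<psi>) = second_quantize N M (rotated_annihilate N M i \<psi>)"
proof
  fix n
  let ?c = "complex_of_real (sqrt (real (Suc (n i))))"
  have "monomial (rotated_annihilate N M) N (n(i := Suc (n i))) \<psi> =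
      monomial (rotated_annihilate N M) N n (rotated_annihilate N M i \<psi>)"
    by (rule monomial_raise) (auto simp: rotated_annihilate_commute assms)
  moreover have "?c \<noteq> 0" by (simp del: of_nat_Suc)
  ultimately show "annihilate i (second_quantize N M \<psi>) n =
      second_quantize N M (rotated_annihilate N M i \<psi>) n"
    unfolding annihilate_def second_quantize_def
    by (simp add: prod_fact_raise real_sqrt_mult upd_in_occupations_iff assms
        del: of_nat_Suc fun_upd_apply)
qed

lemma second_quantize_raise:
  assumes "i < N"
  shows "second_quantize N M \<psi> (n(i := Suc (n i))) =
    second_quantize N M (rotated_annihilate N M i \<psi>) n / complex_of_real (sqrt (real (Suc (n i))))"
  by (simp only: annihilate_raise annihilate_second_quantize[OF assms])

lemma second_quantize_lincomb:
  "second_quantize N M (\<lambda>n. c * \<psi> n + d * \<chi> n) =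
     (\<lambda>n. c * second_quantize N M \<psi> n + d * second_quantize N M \<chi> n)"
proof
  fix n
  show "second_quantize N M (\<lambda>n. c * \<psi> n + d * \<chi> n) n =
      c * second_quantize N M \<psi> n + d * second_quantize N M \<chi> n"
  proof (cases "n \<in> occupations N")
    case True
    then show ?thesis
    \<comment> \<open>The raise rule moves a rotated annihilation into the argument, so the
      hypothesis has to cover all \<psi> and \<chi>.\<close>
    proof (induction arbitrary: \<psi> \<chi> rule: occupations_induct)
      case (raise n i)
      then show ?case
        by (simp only: second_quantize_raise rotated_annihilate_lincomb
            add_divide_distrib times_divide_eq_right)
    qed (simp add: second_quantize_vacuum)
  qed (simp add: second_quantize_outside)
qed

lemma second_quantize_zero: "second_quantize N M (\<lambda>_. 0) = (\<lambda>_. 0)"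
  using second_quantize_lincomb[of N M 0 _ 0] by simp

lemma second_quantize_sum:
  "finite J \<Longrightarrow> second_quantize N M (\<lambda>n. \<Sum>j\<in>J. c j * \<psi> j n) =
     (\<lambda>n. \<Sum>j\<in>J. c j * second_quantize N M (\<psi> j) n)"
proof (induction J rule: finite_induct)
  case (insert j J)
  then show ?case
    using second_quantize_lincomb[of N M "c j" "\<psi> j" 1 "\<lambda>n. \<Sum>j\<in>J. c j * \<psi> j n"] by simp
qed (simp add: second_quantize_zero)

section \<open>Unitary matrices\<close>

lemma mat_adjoint_index:
  assumes "M \<in> carrier_mat n m" "i < m" "j < n"
  shows "mat_adjoint M $$ (i, j) = cnj (M $$ (j, i))"
  using assms by (simp add: mat_adjoint_def mat_of_rows_def)

lemma mat_adjoint_carrier: "M \<in> carrier_mat n m \<Longrightarrow> mat_adjoint M \<in> carrier_mat m n"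
  by (auto simp: mat_adjoint_def)

lemma mult_adjoint_index:
  assumes "M \<in> carrier_mat n m" "i < m" "j < m"
  shows "(mat_adjoint M * M) $$ (i, j) = (\<Sum>k<n. cnj (M $$ (k, i)) * M $$ (k, j))"
  using assms mat_adjoint_carrier[OF assms(1)]
  by (simp add: scalar_prod_def mat_adjoint_index[OF assms(1)] lessThan_atLeast0)

lemma unitary_column_inner:
  assumes "M \<in> unitary_group N" "i < N" "j < N"
  shows "(\<Sum>k<N. cnj (M $$ (k, i)) * M $$ (k, j)) = (if i = j then 1 else 0)"
  using assms mult_adjoint_index[of M N N i j] by (simp add: unitary_group_def)

lemma unitary_groupI:
  assumes M: "M \<in> carrier_mat N N"
    and "\<And>i j. i < N \<Longrightarrow> j < N \<Longrightarrow>
      (\<Sum>k<N. cnj (M $$ (k, i)) * M $$ (k, j)) = (if i = j then 1 else 0)"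
  shows "M \<in> unitary_group N"
proof -
  have "mat_adjoint M * M = 1\<^sub>m N"
    using mat_adjoint_carrier[OF M] M
    by (intro eq_matI) (auto simp: mult_adjoint_index assms(2) simp del: index_mult_mat(1))
  then show ?thesis
    using mat_mult_left_right_inverse[OF mat_adjoint_carrier[OF M] M] M
    by (simp add: unitary_group_def)
qed

lemma mat_adjoint_adjoint: "M \<in> carrier_mat n m \<Longrightarrow> mat_adjoint (mat_adjoint M) = (M :: complex mat)"
  using mat_adjoint_carrier[of M n m] mat_adjoint_carrier[of "mat_adjoint M" m n]
  by (intro eq_matI) (auto simp: mat_adjoint_index)

lemma mat_adjoint_unitary: "M \<in> unitary_group N \<Longrightarrow> mat_adjoint M \<in> unitary_group N"
  by (auto simp: unitary_group_def mat_adjoint_adjoint mat_adjoint_carrier)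

lemma rotated_annihilate_adjoint_compose:
  assumes M: "M \<in> unitary_group N" and "i < N"
  shows "(\<Sum>j<N. mat_adjoint M $$ (i, j) * rotated_annihilate N M j \<psi> n) = annihilate i \<psi> n"
proof -
  have C: "M \<in> carrier_mat N N" using M by (simp add: unitary_group_def)
  have "(\<Sum>j<N. mat_adjoint M $$ (i, j) * rotated_annihilate N M j \<psi> n) =
      (\<Sum>j<N. \<Sum>k<N. cnj (M $$ (j, i)) * M $$ (j, k) * annihilate k \<psi> n)"
    by (simp add: rotated_annihilate_def sum_distrib_left mat_adjoint_index[OF C] assms(2)
        mult.assoc)
  also have "\<dots> = (\<Sum>k<N. (\<Sum>j<N. cnj (M $$ (j, i)) * M $$ (j, k)) * annihilate k \<psi> n)"
    by (subst sum.swap) (simp add: sum_distrib_right)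
  also have "\<dots> = (\<Sum>k<N. if i = k then annihilate k \<psi> n else 0)"
    by (rule sum.cong) (simp_all add: unitary_column_inner[OF M assms(2)])
  finally show ?thesis using assms(2) by simp
qed

text \<open>An annihilator passing through both operators picks up the rotations by the adjoint of
  \<open>M\<close> and by \<open>M\<close>, which cancel. It reaches \<psi> as
  \<open>annihilate i\<close>, and the pattern has lost one photon.\<close>

lemma second_quantize_adjoint_inverse:
  assumes M: "M \<in> unitary_group N" and "n \<in> occupations N"
  shows "second_quantize N (mat_adjoint M) (second_quantize N M \<psi>) n = \<psi> n"
  using assms(2)
proof (induction arbitrary: \<psi> rule: occupations_induct)
  case (raise n i)
  have "rotated_annihilate N (mat_adjoint M) i (second_quantize N M \<psi>) =
      second_quantize N M (annihilate i \<psi>)"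
    using \<open>i < N\<close>
    by (simp add: rotated_annihilate_def[of N "mat_adjoint M"] annihilate_second_quantize
        rotated_annihilate_adjoint_compose[OF M] flip: second_quantize_sum)
  with raise show ?case
    by (simp only: second_quantize_raise annihilate_raise[of \<psi>])
qed (simp add: second_quantize_vacuum)

section \<open>Isometry\<close>

definition sector_inner :: "nat \<Rightarrow> nat \<Rightarrow> fock_vec \<Rightarrow> fock_vec \<Rightarrow> complex" where
  "sector_inner N d \<psi> \<chi> = (\<Sum>n\<in>sector N d. cnj (\<psi> n) * \<chi> n)"

text \<open>The left-hand side is a matrix element of the total number operator, the sum of
  \<open>a_i^dagger a_i\<close>, whose value on \<open>d + 1\<close> photons is
  \<open>Suc d\<close>.\<close>

lemma sector_inner_number:
  "(\<Sum>i<N. sector_inner N d (annihilate i \<psi>) (annihilate i \<chi>)) =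
     of_nat (Suc d) * sector_inner N (Suc d) \<psi> \<chi>"
proof -
  have s: "complex_of_real (sqrt (real k)) * (complex_of_real (sqrt (real k)) * z) = of_nat k * z"
    for k z
    by (simp flip: of_real_mult mult.assoc)
  have "(\<Sum>i<N. sector_inner N d (annihilate i \<psi>) (annihilate i \<chi>)) =
      (\<Sum>i<N. \<Sum>n\<in>sector N d. of_nat (Suc (n i)) *
         (cnj (\<psi> (n(i := Suc (n i)))) * \<chi> (n(i := Suc (n i)))))"
    unfolding sector_inner_def annihilate_def complex_cnj_mult complex_cnj_complex_of_real
    by (intro sum.cong refl) (simp add: s[symmetric] mult_ac del: of_nat_Suc)
  also have "\<dots> = (\<Sum>i<N. \<Sum>n\<in>sector N (Suc d). of_nat (n i) * (cnj (\<psi> n) * \<chi> n))"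
    by (intro sum.cong refl sum_sector_raise) simp
  also have "\<dots> = (\<Sum>n\<in>sector N (Suc d). of_nat (\<Sum>i<N. n i) * (cnj (\<psi> n) * \<chi> n))"
    by (subst sum.swap) (simp add: sum_distrib_right)
  also have "\<dots> = of_nat (Suc d) * sector_inner N (Suc d) \<psi> \<chi>"
    unfolding sector_inner_def sum_distrib_left
    by (intro sum.cong refl) (simp add: sector_def del: of_nat_sum of_nat_Suc)
  finally show ?thesis .
qed

text \<open>At each pattern separately, the tuple of annihilated amplitudes is rotated by the
  unitary \<open>M\<close>, which preserves inner products.\<close>

lemma sector_inner_rotated:
  assumes M: "M \<in> unitary_group N"
  shows "(\<Sum>i<N. sector_inner N d (rotated_annihilate N M i \<psi>) (rotated_annihilate N M i \<chi>)) =
    (\<Sum>i<N. sector_inner N d (annihilate i \<psi>) (annihilate i \<chi>))"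
proof -
  have "(\<Sum>i<N. cnj (rotated_annihilate N M i \<psi> n) * rotated_annihilate N M i \<chi> n) =
      (\<Sum>j<N. cnj (annihilate j \<psi> n) * annihilate j \<chi> n)" (is "?L n = ?R n") for n
  proof -
    have "?L n = (\<Sum>i<N. \<Sum>j<N. \<Sum>k<N. cnj (M $$ (i, j) * annihilate j \<psi> n) *
        (M $$ (i, k) * annihilate k \<chi> n))"
      by (simp only: rotated_annihilate_def cnj_sum sum_product)
    also have "\<dots> = (\<Sum>i<N. \<Sum>j<N. \<Sum>k<N. (cnj (M $$ (i, j)) * M $$ (i, k)) *
        (cnj (annihilate j \<psi> n) * annihilate k \<chi> n))"
      by (simp add: mult_ac)
    also have "\<dots> = (\<Sum>j<N. \<Sum>k<N. \<Sum>i<N. (cnj (M $$ (i, j)) * M $$ (i, k)) *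
        (cnj (annihilate j \<psi> n) * annihilate k \<chi> n))"
      by (subst sum.swap, rule sum.cong[OF refl], rule sum.swap)
    also have "\<dots> = (\<Sum>j<N. \<Sum>k<N. if j = k then cnj (annihilate j \<psi> n) * annihilate k \<chi> n else 0)"
      unfolding sum_distrib_right[symmetric]
      by (intro sum.cong refl) (simp add: unitary_column_inner[OF M])
    finally show ?thesis by simp
  qed
  then show ?thesis
    unfolding sector_inner_def by (subst (1 2) sum.swap) simp
qed

text \<open>Induction on the photon number: the number identity trades \<open>d + 1\<close> photons
  for \<open>d\<close>, the annihilators pass through the operator as rotated ones, and the rotation
  drops out of the sum over modes.\<close>

lemma sector_inner_second_quantize:
  assumes M: "M \<in> unitary_group N"
  shows "sector_inner N d (second_quantize N M \<psi>) (second_quantize N M \<chi>) = sector_inner N d \<psi> \<chi>"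
proof (induction d arbitrary: \<psi> \<chi>)
  case 0
  show ?case by (simp add: sector_inner_def sector_0 second_quantize_vacuum)
next
  case (Suc d)
  have "of_nat (Suc d) * sector_inner N (Suc d) (second_quantize N M \<psi>) (second_quantize N M \<chi>) =
      of_nat (Suc d) * sector_inner N (Suc d) \<psi> \<chi>"
    by (simp add: annihilate_second_quantize Suc sector_inner_rotated[OF M]
        del: of_nat_Suc flip: sector_inner_number)
  moreover have "(of_nat (Suc d) :: complex) \<noteq> 0" by (simp only: of_nat_eq_0_iff)
  ultimately show ?case by (metis mult_left_cancel)
qed

text \<open>Each finite set of patterns lies below some photon number cutoff, so a convergent sum
  over all patterns is the limit of its sums up to a cutoff.\<close>

lemma cumulative_sector_filter:
  "filterlim (\<lambda>D. \<Union>d\<le>D. sector N d) (finite_subsets_at_top (occupations N)) sequentially"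
  unfolding filterlim_iff
proof safe
  fix P :: "occupation set \<Rightarrow> bool"
  assume "eventually P (finite_subsets_at_top (occupations N))"
  then obtain X where X: "finite X" "X \<subseteq> occupations N"
    "\<And>Y. finite Y \<Longrightarrow> X \<subseteq> Y \<Longrightarrow> Y \<subseteq> occupations N \<Longrightarrow> P Y"
    by (auto simp: eventually_finite_subsets_at_top)
  obtain D where D: "\<And>n. n \<in> X \<Longrightarrow> (\<Sum>i<N. n i) \<le> D"
    using finite_nat_set_iff_bounded_le[of "(\<lambda>n. \<Sum>i<N. n i) ` X"] X(1) by auto
  have "P (\<Union>d\<le>E. sector N d)" if "E \<ge> D" for E
  proof (rule X(3))
    show "X \<subseteq> (\<Union>d\<le>E. sector N d)"
      using X(2) D that by (fastforce simp: sector_def)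
  qed (auto simp: finite_sector, auto simp: sector_def)
  then show "\<forall>\<^sub>F D in sequentially. P (\<Union>d\<le>D. sector N d)"
    by (auto simp: eventually_sequentially)
qed

lemma sum_cumulative_sector:
  "sum f (\<Union>d\<le>D. sector N d) = (\<Sum>d\<le>D. sum f (sector N d))"
  by (rule sum.UNION_disjoint) (auto simp: finite_sector, auto simp: sector_def)

lemma summable_on_occupations_iff:
  fixes f :: "occupation \<Rightarrow> 'a::{comm_monoid_add, topological_space}"
  assumes "\<And>n. n \<notin> occupations N \<Longrightarrow> f n = 0"
  shows "f summable_on UNIV \<longleftrightarrow> f summable_on occupations N"
  by (rule summable_on_cong_neutral) (auto simp: assms)

text \<open>A divergent infinite sum has the default value 0, so \<open>fock_inner\<close> is
  meaningful only with summability. It follows from |xy| \<le> |x|^2 + |y|^2.\<close>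

lemma fock_inner_summable:
  assumes "\<psi> \<in> fock N" "\<chi> \<in> fock N"
  shows "(\<lambda>n. cnj (\<psi> n) * \<chi> n) summable_on UNIV"
proof -
  have "(\<lambda>n. (cmod (\<psi> n))\<^sup>2 + (cmod (\<chi> n))\<^sup>2) summable_on UNIV"
    using assms by (auto simp: fock_def intro: summable_on_add)
  then have "(\<lambda>n. (cmod (\<psi> n))\<^sup>2 + (cmod (\<chi> n))\<^sup>2) abs_summable_on UNIV"
    by (rule iffD1[OF summable_on_iff_abs_summable_on_real])
  then have "(\<lambda>n. cnj (\<psi> n) * \<chi> n) abs_summable_on UNIV"
  proof (rule abs_summable_on_comparison_test)
    fix n
    have "0 \<le> cmod (\<psi> n) * cmod (\<chi> n)" by simp
    with sum_squares_bound[of "cmod (\<psi> n)" "cmod (\<chi> n)"]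
    have "cmod (\<psi> n) * cmod (\<chi> n) \<le> (cmod (\<psi> n))\<^sup>2 + (cmod (\<chi> n))\<^sup>2" by linarith
    then show "norm (cnj (\<psi> n) * \<chi> n) \<le> norm ((cmod (\<psi> n))\<^sup>2 + (cmod (\<chi> n))\<^sup>2)"
      by (simp add: norm_mult)
  qed
  then show ?thesis by (rule abs_summable_summable)
qed

lemma fock_inner_eq_sector_limit:
  assumes "\<psi> \<in> fock N" "\<chi> \<in> fock N"
  shows "(\<lambda>D. \<Sum>d\<le>D. sector_inner N d \<psi> \<chi>) \<longlonglongrightarrow> fock_inner \<psi> \<chi>"
proof -
  let ?f = "\<lambda>n. cnj (\<psi> n) * \<chi> n"
  have "(?f has_sum fock_inner \<psi> \<chi>) UNIV"
    unfolding fock_inner_def by (rule has_sum_infsum[OF fock_inner_summable[OF assms]])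
  then have "(?f has_sum fock_inner \<psi> \<chi>) (occupations N)"
    by (rule iffD1[OF has_sum_cong_neutral, rotated -1]) (use assms in \<open>auto simp: fock_def\<close>)
  then have "(\<lambda>D. sum ?f (\<Union>d\<le>D. sector N d)) \<longlonglongrightarrow> fock_inner \<psi> \<chi>"
    unfolding has_sum_def by (rule filterlim_compose[OF _ cumulative_sector_filter])
  then show ?thesis
    by (simp add: sum_cumulative_sector sector_inner_def)
qed

lemma sum_cmod_sector: "(\<Sum>n\<in>sector N d. (cmod (\<psi> n))\<^sup>2) = Re (sector_inner N d \<psi> \<psi>)"
  unfolding sector_inner_def Re_sum
  by (intro sum.cong refl) (simp add: cmod_power2 flip: power2_eq_square)

lemma second_quantize_in_fock:
  assumes M: "M \<in> unitary_group N" and \<psi>: "\<psi> \<in> fock N"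
  shows "second_quantize N M \<psi> \<in> fock N"
proof -
  let ?g = "\<lambda>n. (cmod (second_quantize N M \<psi> n))\<^sup>2" and ?f = "\<lambda>n. (cmod (\<psi> n))\<^sup>2"
  have "?g summable_on occupations N"
  proof (rule nonneg_bdd_above_summable_on)
    show "bdd_above (sum ?g ` {F. F \<subseteq> occupations N \<and> finite F})"
    proof (rule bdd_aboveI2)
      fix F assume F: "F \<in> {F. F \<subseteq> occupations N \<and> finite F}"
      \<comment> \<open>A cutoff above all photon numbers in \<open>F\<close>. Up to it the operator
        preserves the squared norm exactly, which bounds the partial sum.\<close>
      obtain D where D: "\<And>n. n \<in> F \<Longrightarrow> (\<Sum>i<N. n i) \<le> D"
        using finite_nat_set_iff_bounded_le[of "(\<lambda>n. \<Sum>i<N. n i) ` F"] F by auto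
      have "sum ?g F \<le> sum ?g (\<Union>d\<le>D. sector N d)"
        by (rule sum_mono2) (use F D in \<open>auto simp: finite_sector, fastforce simp: sector_def\<close>)
      also have "\<dots> = sum ?f (\<Union>d\<le>D. sector N d)"
        by (simp add: sum_cumulative_sector sum_cmod_sector sector_inner_second_quantize[OF M])
      also have "\<dots> \<le> infsum ?f UNIV"
        by (rule finite_sum_le_infsum) (use \<psi> in \<open>auto simp: fock_def finite_sector\<close>)
      finally show "sum ?g F \<le> infsum ?f UNIV" .
    qed
  qed simp
  then show ?thesis
    using summable_on_occupations_iff[of N ?g] by (simp add: fock_def second_quantize_outside)
qed

lemma fock_eqI:
  assumes "\<psi> \<in> fock N" "\<chi> \<in> fock N" "\<And>n. n \<in> occupations N \<Longrightarrow> \<psi> n = \<chi> n"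
  shows "\<psi> = \<chi>"
proof
  fix n show "\<psi> n = \<chi> n"
    using assms by (cases "n \<in> occupations N") (auto simp: fock_def)
qed

text \<open>The inverse is the operator of the adjoint matrix. Inner products agree because their
  sums up to each photon number agree.\<close>

lemma second_quantize_unitary:
  assumes M: "M \<in> unitary_group N"
  shows "fock_unitary N (second_quantize N M)"
  unfolding fock_unitary_def
proof (intro conjI ballI allI)
  let ?U = "second_quantize N M" and ?V = "second_quantize N (mat_adjoint M)"
  note M' = mat_adjoint_unitary[OF M]
  have C: "M \<in> carrier_mat N N" using M by (simp add: unitary_group_def)
  show "bij_betw ?U (fock N) (fock N)"
  proof (rule bij_betw_byWitness[of _ ?V])
    show "\<forall>\<psi>\<in>fock N. ?V (?U \<psi>) = \<psi>"
      by (intro ballI fock_eqI[of _ N])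
         (auto simp: second_quantize_in_fock M M' second_quantize_adjoint_inverse)
    show "\<forall>\<psi>\<in>fock N. ?U (?V \<psi>) = \<psi>"
      using second_quantize_adjoint_inverse[OF M'] mat_adjoint_adjoint[OF C]
      by (intro ballI fock_eqI[of _ N]) (auto simp: second_quantize_in_fock M M')
  qed (auto simp: second_quantize_in_fock M M')
  show "?U (\<lambda>n. c * \<psi> n + d * \<chi> n) = (\<lambda>n. c * ?U \<psi> n + d * ?U \<chi> n)" for \<psi> \<chi> c d
    by (rule second_quantize_lincomb)
  show "fock_inner (?U \<psi>) (?U \<chi>) = fock_inner \<psi> \<chi>" if "\<psi> \<in> fock N" "\<chi> \<in> fock N" for \<psi> \<chi>
    using fock_inner_eq_sector_limit[OF that]
      fock_inner_eq_sector_limit[OF that[THEN second_quantize_in_fock[OF M]]]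
    by (simp add: sector_inner_second_quantize[OF M] LIMSEQ_unique)
qed

section \<open>Linear structure of Fock space and existence of passive transformations\<close>

lemma fock_lincomb:
  assumes "\<psi> \<in> fock N" "\<chi> \<in> fock N"
  shows "(\<lambda>n. c * \<psi> n + d * \<chi> n) \<in> fock N"
proof -
  have "(\<lambda>n. 2 * (cmod c)\<^sup>2 * (cmod (\<psi> n))\<^sup>2 + 2 * (cmod d)\<^sup>2 * (cmod (\<chi> n))\<^sup>2) summable_on UNIV"
    using assms by (auto simp: fock_def intro!: summable_on_add summable_on_cmult_right)
  then have "(\<lambda>n. (cmod (c * \<psi> n + d * \<chi> n))\<^sup>2) summable_on UNIV"
  proof (rule summable_on_comparison_test)
    fix n
    have "(cmod (c * \<psi> n + d * \<chi> n))\<^sup>2 \<le> (cmod (c * \<psi> n) + cmod (d * \<chi> n))\<^sup>2"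
      by (intro power_mono norm_triangle_ineq) simp
    also have "\<dots> \<le> 2 * (cmod (c * \<psi> n))\<^sup>2 + 2 * (cmod (d * \<chi> n))\<^sup>2"
      using sum_squares_bound[of "cmod (c * \<psi> n)" "cmod (d * \<chi> n)"]
      by (simp add: power2_sum)
    finally show "(cmod (c * \<psi> n + d * \<chi> n))\<^sup>2 \<le>
        2 * (cmod c)\<^sup>2 * (cmod (\<psi> n))\<^sup>2 + 2 * (cmod d)\<^sup>2 * (cmod (\<chi> n))\<^sup>2"
      by (simp add: norm_mult power_mult_distrib)
  qed simp
  then show ?thesis
    using assms by (simp add: fock_def)
qed

lemma fock_zero: "(\<lambda>_. 0) \<in> fock N"
  by (simp add: fock_def)

lemma fock_sum:
  "finite J \<Longrightarrow> (\<And>j. j \<in> J \<Longrightarrow> \<psi> j \<in> fock N) \<Longrightarrow> (\<lambda>n. \<Sum>j\<in>J. c j * \<psi> j n) \<in> fock N"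
proof (induction J rule: finite_induct)
  case (insert j J)
  then show ?case
    using fock_lincomb[of "\<psi> j" N "\<lambda>n. \<Sum>j\<in>J. c j * \<psi> j n" "c j" 1] by simp
qed (simp add: fock_zero)

lemma ket_vacuum: "ket (replicate N 0) = ket_occ (\<lambda>_. 0)"
  by (auto simp: ket_def intro!: arg_cong[of _ _ ket_occ])

lemma annihilate_ket_occ:
  "annihilate i (ket_occ k) = (\<lambda>n. complex_of_real (sqrt (real (k i))) * ket_occ (k(i := k i - 1)) n)"
proof
  fix n
  have "n(i := Suc (n i)) = k \<longleftrightarrow> k i > 0 \<and> n = k(i := k i - 1)"
    by (auto simp: fun_eq_iff)
  then show "annihilate i (ket_occ k) n =
      complex_of_real (sqrt (real (k i))) * ket_occ (k(i := k i - 1)) n"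
    by (auto simp: annihilate_def ket_occ_def)
qed

lemma second_quantize_ket_vacuum:
  "second_quantize N M (ket_occ (\<lambda>_. 0)) = ket_occ (\<lambda>_. 0)"
proof
  fix n
  show "second_quantize N M (ket_occ (\<lambda>_. 0)) n = ket_occ (\<lambda>_. 0) n"
  proof (cases "n \<in> occupations N")
    case True
    then show ?thesis
    proof (cases rule: occupations_cases)
      case (raise i k)
      have "rotated_annihilate N M i (ket_occ (\<lambda>_. 0)) = (\<lambda>_. 0)"
        by (simp add: rotated_annihilate_def annihilate_ket_occ)
      then have "second_quantize N M (ket_occ (\<lambda>_. 0)) n = 0"
        by (simp only: raise(3) second_quantize_raise[OF raise(1)] second_quantize_zero) simp
      moreover have "n \<noteq> (\<lambda>_. 0)"
        using raise(3) by (metis fun_upd_same nat.simps(3))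
      ultimately show ?thesis by (simp add: ket_occ_def)
    qed (simp add: second_quantize_vacuum)
  next
    case False
    then show ?thesis by (auto simp: second_quantize_outside ket_occ_def)
  qed
qed

text \<open>Every unitary matrix thus has a passive transformation, which later supplies the
  competitor with one ancillary mode.\<close>

lemma lop_second_quantize:
  assumes M: "M \<in> unitary_group N"
  shows "lop N M (second_quantize N M)"
proof -
  let ?U = "second_quantize N M"
  note U = second_quantize_unitary[OF M]
  have inj: "inj_on ?U (fock N)"
    using U by (simp add: fock_unitary_def bij_betw_def)
  have "?U \<psi> \<in> ladder_domain N \<and>
      (\<forall>i<N. inv_into (fock N) ?U (annihilate i (?U \<psi>)) =
        (\<lambda>n. \<Sum>j<N. M $$ (i, j) * annihilate j \<psi> n))" if \<psi>: "\<psi> \<in> ladder_domain N" for \<psi>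
  proof -
    \<comment> \<open>\<open>inv_into\<close> recovers only preimages that lie in Fock
      space.\<close>
    have "rotated_annihilate N M i \<psi> \<in> fock N" for i
      unfolding rotated_annihilate_def using \<psi> by (intro fock_sum) (auto simp: ladder_domain_def)
    then show ?thesis
      using \<psi> by (auto simp: ladder_domain_def annihilate_second_quantize inv_into_f_f[OF inj]
          second_quantize_in_fock[OF M]) (simp_all add: rotated_annihilate_def)
  qed
  with U show ?thesis
    by (simp add: lop_def ket_vacuum second_quantize_ket_vacuum)
qed

section \<open>The post-selected state of a passive transformation\<close>

text \<open>\<open>U\<close> keeps the ladder domain, so the annihilated vector lies in the range of
  \<open>U\<close> and the inverse in the definition of \<open>lop\<close> can be undone.\<close>

lemma lop_annihilate:
  assumes U: "lop N M U" and \<psi>: "\<psi> \<in> ladder_domain N" and "i < N"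
  shows "annihilate i (U \<psi>) = U (rotated_annihilate N M i \<psi>)"
proof -
  have "annihilate i (U \<psi>) \<in> U ` fock N"
    using assms by (auto simp: lop_def fock_unitary_def bij_betw_def ladder_domain_def)
  moreover have "inv_into (fock N) U (annihilate i (U \<psi>)) = rotated_annihilate N M i \<psi>"
    using assms by (simp add: lop_def rotated_annihilate_def)
  ultimately show ?thesis by (metis f_inv_into_f)
qed

lemma ket_occ_in_fock:
  assumes "k \<in> occupations N"
  shows "ket_occ k \<in> fock N"
proof -
  have "(\<lambda>n. (cmod (ket_occ k n))\<^sup>2) summable_on UNIV \<longleftrightarrow>
      (\<lambda>n. (cmod (ket_occ k n))\<^sup>2) summable_on {k}"
    by (rule summable_on_cong_neutral) (auto simp: ket_occ_def)
  with assms show ?thesis by (auto simp: fock_def ket_occ_def)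
qed

lemma ket_occ_in_ladder_domain:
  assumes "k \<in> occupations N"
  shows "ket_occ k \<in> ladder_domain N"
proof -
  have "annihilate j (ket_occ k) \<in> fock N" if "j < N" for j
    using fock_lincomb[of "ket_occ (k(j := k j - 1))" N "\<lambda>_. 0" "complex_of_real (sqrt (real (k j)))" 0]
      that assms
    by (simp add: annihilate_ket_occ ket_occ_in_fock fock_zero upd_in_occupations_iff)
  then show ?thesis
    using assms by (simp add: ladder_domain_def ket_occ_in_fock)
qed

lemma fock_inner_ket_occ: "fock_inner (ket_occ k) \<psi> = \<psi> k"
proof -
  have "fock_inner (ket_occ k) \<psi> = (\<Sum>\<^sub>\<infinity>n\<in>{k}. \<psi> n)"
    unfolding fock_inner_def by (rule infsum_cong_neutral) (auto simp: ket_occ_def)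
  then show ?thesis by simp
qed

text \<open>With \<open>N = 2\<close> this recovers the amplitudes with empty ancillary modes from
  the annihilators of modes 0 and 1 alone.\<close>

lemma amplitudes_eqI:
  assumes "\<psi> (\<lambda>_. 0) = \<chi> (\<lambda>_. 0)"
    and "\<And>i n. i < N \<Longrightarrow> n \<in> occupations N \<Longrightarrow> annihilate i \<psi> n = annihilate i \<chi> n"
    and "n \<in> occupations N"
  shows "\<psi> n = \<chi> n"
  using assms(3)
proof (cases rule: occupations_cases)
  case (raise i k)
  with assms(2) show ?thesis by (simp only: annihilate_raise)
qed (simp add: assms(1))

section \<open>Number states of the first two modes\<close>

definition two_mode :: "nat \<Rightarrow> nat \<Rightarrow> occupation" where
  "two_mode a b = (\<lambda>i. if i = 0 then a else if i = 1 then b else 0)"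

lemma two_mode_simps [simp]:
  "two_mode a b 0 = a" "two_mode a b (Suc 0) = b" "two_mode a b (Suc (Suc j)) = 0"
  "(two_mode a b)(0 := c) = two_mode c b" "(two_mode a b)(Suc 0 := c) = two_mode a c"
  by (auto simp: two_mode_def)

lemma two_mode_eq_iff [simp]: "two_mode a b = two_mode c d \<longleftrightarrow> a = c \<and> b = d"
  by (metis two_mode_simps(1,2))

lemma two_mode_vacuum: "(\<lambda>_. 0) = two_mode 0 0"
  by (auto simp: two_mode_def)

lemma two_mode_in_occupations: "two_mode a b \<in> occupations (2 + m)"
  by (auto simp: occupations_def two_mode_def)

lemma ket_two_mode: "ket [a, b] = ket_occ (two_mode a b)"
  unfolding ket_def
  by (rule arg_cong[of _ _ ket_occ]) (auto simp: two_mode_def nth_Cons split: nat.split)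

lemma ket_append_replicate: "ket (xs @ replicate m 0) = ket xs"
  unfolding ket_def by (rule arg_cong[of _ _ ket_occ]) (auto simp: nth_append)

text \<open>Annihilators of empty modes contribute nothing. When \<open>a\<close> or
  \<open>b\<close> is 0, the truncated subtraction is harmless because the root in front
  vanishes.\<close>

lemma rotated_annihilate_two_mode:
  "rotated_annihilate (2 + m) M i (ket_occ (two_mode a b)) =
     (\<lambda>n. M $$ (i, 0) * complex_of_real (sqrt (real a)) * ket_occ (two_mode (a - 1) b) n +
          M $$ (i, 1) * complex_of_real (sqrt (real b)) * ket_occ (two_mode a (b - 1)) n)"
proof
  fix n
  have "rotated_annihilate (2 + m) M i (ket_occ (two_mode a b)) n =
      (\<Sum>j\<in>{0, 1}. M $$ (i, j) * annihilate j (ket_occ (two_mode a b)) n)"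
    unfolding rotated_annihilate_def
    by (rule sum.mono_neutral_right) (auto simp: annihilate_ket_occ two_mode_def)
  then show "rotated_annihilate (2 + m) M i (ket_occ (two_mode a b)) n =
     M $$ (i, 0) * complex_of_real (sqrt (real a)) * ket_occ (two_mode (a - 1) b) n +
     M $$ (i, 1) * complex_of_real (sqrt (real b)) * ket_occ (two_mode a (b - 1)) n"
    by (simp add: annihilate_ket_occ)
qed

lemma annihilate_add: "annihilate i (\<lambda>n. \<psi> n + \<chi> n) = (\<lambda>n. annihilate i \<psi> n + annihilate i \<chi> n)"
  using annihilate_lincomb[of i 1 \<psi> 1 \<chi>] by simp

lemma annihilate_scale: "annihilate i (\<lambda>n. c * \<psi> n) = (\<lambda>n. c * annihilate i \<psi> n)"
  using annihilate_lincomb[of i c \<psi> 0 \<psi>] by simp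

text \<open>Removing photons one at a time leads from the image of the two-photon state over the
  one-photon images down to the vacuum, which \<open>U\<close> fixes. Only annihilators of modes 0
  and 1 enter, hence only the upper left block of \<open>M\<close>.\<close>

lemma postselected_lop:
  assumes U: "lop (2 + m) M U"
  shows "postselected m U = (\<lambda>n.
      complex_of_real (sqrt 2) * (M $$ (0, 0) * M $$ (0, 1)) * ket [2, 0] n +
      (M $$ (0, 0) * M $$ (1, 1) + M $$ (1, 0) * M $$ (0, 1)) * ket [1, 1] n +
      complex_of_real (sqrt 2) * (M $$ (1, 0) * M $$ (1, 1)) * ket [0, 2] n)"
    (is "_ = ?G")
proof -
  let ?N = "2 + m"
  let ?k = "\<lambda>a b. ket_occ (two_mode a b)"
  have k: "?k a b \<in> fock ?N" for a b
    by (simp only: ket_occ_in_fock two_mode_in_occupations)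
  have lin: "U (\<lambda>n. c * ?k a b n + d * ?k a' b' n) = (\<lambda>n. c * U (?k a b) n + d * U (?k a' b') n)"
    for c d a b a' b'
    using U k by (simp add: lop_def fock_unitary_def)
  have vac: "U (?k 0 0) = ?k 0 0"
    using U by (simp only: lop_def ket_vacuum two_mode_vacuum)
  have ann: "annihilate i (U (?k a b)) =
      (\<lambda>n. M $$ (i, 0) * complex_of_real (sqrt (real a)) * U (?k (a - 1) b) n +
           M $$ (i, 1) * complex_of_real (sqrt (real b)) * U (?k a (b - 1)) n)"
    if "i < ?N" for i a b
    using lop_annihilate[OF U ket_occ_in_ladder_domain[OF two_mode_in_occupations] that]
    by (simp only: rotated_annihilate_two_mode lin)
  \<comment> \<open>An isometry that fixes the vacuum preserves overlaps with it.\<close>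
  have at_0: "U (?k a b) (\<lambda>_. 0) = ?k a b (\<lambda>_. 0)" for a b
  proof -
    have "fock_inner (U (?k 0 0)) (U (?k a b)) = fock_inner (?k 0 0) (?k a b)"
      using U k by (simp add: lop_def fock_unitary_def)
    then show ?thesis by (simp only: vac fock_inner_ket_occ two_mode_vacuum)
  qed
  have k_0: "?k a b (\<lambda>_. 0) = (if a = 0 \<and> b = 0 then 1 else 0)" for a b
    by (simp add: ket_occ_def two_mode_vacuum)
  have U10: "U (?k 1 0) n = M $$ (0, 0) * ?k 1 0 n + M $$ (1, 0) * ?k 0 1 n"
    if "n \<in> occupations 2" for n
    by (rule amplitudes_eqI[OF _ _ that])
       (auto simp: at_0 k_0 ann vac annihilate_lincomb annihilate_ket_occ dest!: less_2_cases)
  have U01: "U (?k 0 1) n = M $$ (0, 1) * ?k 1 0 n + M $$ (1, 1) * ?k 0 1 n"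
    if "n \<in> occupations 2" for n
    by (rule amplitudes_eqI[OF _ _ that])
       (auto simp: at_0 k_0 ann vac annihilate_lincomb annihilate_ket_occ dest!: less_2_cases)
  have s: "complex_of_real (sqrt 2) * (complex_of_real (sqrt 2) * x) = 2 * x" for x
    by (simp flip: of_real_mult mult.assoc)
  have U11: "U (?k 1 1) n = ?G n" if "n \<in> occupations 2" for n
  proof (rule amplitudes_eqI[OF _ _ that])
    show "U (?k 1 1) (\<lambda>_. 0) = ?G (\<lambda>_. 0)"
      by (simp add: at_0 ket_two_mode k_0)
    fix i n assume i: "i < (2::nat)" and n: "n \<in> occupations 2"
    have "annihilate i (U (?k 1 1)) n =
        M $$ (i, 0) * (M $$ (0, 1) * ?k 1 0 n + M $$ (1, 1) * ?k 0 1 n) +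
        M $$ (i, 1) * (M $$ (0, 0) * ?k 1 0 n + M $$ (1, 0) * ?k 0 1 n)"
      using i by (simp add: ann U10[OF n, simplified] U01[OF n, simplified])
    also have "\<dots> = annihilate i ?G n"
      using less_2_cases[OF i]
      by (auto simp: ket_two_mode annihilate_add annihilate_scale annihilate_ket_occ)
         (simp_all add: s algebra_simps)
    finally show "annihilate i (U (?k 1 1)) n = annihilate i ?G n" .
  qed
  have out: "?k a b n = 0" if "n \<notin> occupations 2" for a b n
    using that two_mode_in_occupations[of a b 0] by (auto simp: ket_occ_def)
  show ?thesis
  proof
    fix n
    have "postselected m U n = (if n \<in> occupations 2 then U (?k 1 1) n else 0)"
      by (simp only: postselected_def project_vacuum_def ket_append_replicate ket_two_mode)
    then show "postselected m U n = ?G n"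
      using U11[of n] out[of n] by (simp add: ket_two_mode)
  qed
qed

section \<open>Dilating a rescaled block to a unitary matrix\<close>

text \<open>
  For the Gram matrix of a contraction with diagonal \<open>a\<close>, \<open>b\<close> and off-diagonal modulus \<open>r\<close>, the
  factor \<open>t\<close> is the inverse of the largest eigenvalue.
\<close>

lemma gram_rescale:
  fixes a b r :: real
  assumes "0 \<le> a" "0 \<le> b" "a + b > 0" "a \<le> 1" "b \<le> 1" "r\<^sup>2 \<le> (1 - a) * (1 - b)"
  obtains t where "t \<ge> 1" "t * a \<le> 1" "t * b \<le> 1" "(t * r)\<^sup>2 = (1 - t * a) * (1 - t * b)"
proof -
  \<comment> \<open>\<open>l\<close> is the larger root of the characteristic equation (l - a)(l -
    b) = r^2, and \<open>s\<close> is the root of its discriminant.\<close>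
  define s where "s = sqrt ((a - b)\<^sup>2 + 4 * r\<^sup>2)"
  define l where "l = (a + b + s) / 2"
  have s2: "s\<^sup>2 = (a - b)\<^sup>2 + 4 * r\<^sup>2" unfolding s_def by simp
  have "s \<ge> 0" unfolding s_def by simp
  have "sqrt ((a - b)\<^sup>2) \<le> s" unfolding s_def by (intro real_sqrt_le_mono) simp
  then have ab: "\<bar>a - b\<bar> \<le> s" by simp
  \<comment> \<open>By (2 - a - b)^2 - (a - b)^2 = 4 (1 - a)(1 - b), this is the contraction
    hypothesis.\<close>
  have "s \<le> sqrt ((2 - a - b)\<^sup>2)"
    unfolding s_def using assms(6)
    by (intro real_sqrt_le_mono) (simp add: power2_eq_square algebra_simps)
  then have "l \<le> 1" using assms(4,5) by (simp add: l_def)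
  have "l > 0" using assms(3) \<open>s \<ge> 0\<close> by (simp add: l_def)
  have la: "a \<le> l" "b \<le> l" using ab by (auto simp: l_def)
  have l: "l - a = (s - (a - b)) / 2" "l - b = (s + (a - b)) / 2"
    by (simp_all add: l_def field_simps)
  have "(l - a) * (l - b) = (s\<^sup>2 - (a - b)\<^sup>2) / 4"
    unfolding l by (simp add: power2_eq_square field_simps)
  then have det: "(l - a) * (l - b) = r\<^sup>2"
    by (simp add: s2)
  show thesis
  proof (rule that[of "1 / l"])
    have "(1 / l * r)\<^sup>2 = (l - a) * (l - b) / l\<^sup>2"
      by (simp add: det power_divide)
    also have "\<dots> = (1 - 1 / l * a) * (1 - 1 / l * b)"
      using \<open>l > 0\<close> by (simp add: field_simps power2_eq_square)
    finally show "(1 / l * r)\<^sup>2 = (1 - 1 / l * a) * (1 - 1 / l * b)" .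
  qed (use \<open>l > 0\<close> \<open>l \<le> 1\<close> la in auto)
qed

text \<open>A positive semidefinite 2 by 2 matrix with vanishing determinant has rank at most one,
  so it is the Gram matrix of two scalars. They will fill the single ancillary row.\<close>

lemma rank_one_gram:
  fixes z :: complex
  assumes "0 \<le> p" "0 \<le> q" "(cmod z)\<^sup>2 = p * q"
  obtains u v where "cnj u * u = of_real p" "cnj v * v = of_real q" "cnj u * v = z"
proof (cases "p = 0")
  case True
  with assms show ?thesis
    by (intro that[of 0 "of_real (sqrt q)"]) (auto simp flip: of_real_mult)
next
  case False
  have "cnj z * z = of_real (p * q)"
    using assms(3) complex_norm_square[of z] by (simp add: mult.commute)
  moreover have "complex_of_real (sqrt p) * complex_of_real (sqrt p) = of_real p"
    using assms(1) by (simp flip: of_real_mult)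
  ultimately show ?thesis
    using False assms
    by (intro that[of "of_real (sqrt p)" "z / of_real (sqrt p)"]) auto
qed

text \<open>The missing third column is the conjugate of the cross product of the first two.\<close>

lemma unitary_3_from_columns:
  fixes x0 x1 x2 y0 y1 y2 :: complex
  assumes x: "cnj x0 * x0 + cnj x1 * x1 + cnj x2 * x2 = 1"
    and y: "cnj y0 * y0 + cnj y1 * y1 + cnj y2 * y2 = 1"
    and xy: "cnj x0 * y0 + cnj x1 * y1 + cnj x2 * y2 = 0"
  obtains M where "M \<in> unitary_group 3"
    "M $$ (0, 0) = x0" "M $$ (1, 0) = x1" "M $$ (0, 1) = y0" "M $$ (1, 1) = y1"
proof -
  define z0 z1 z2 where z: "z0 = cnj (x1 * y2 - x2 * y1)" "z1 = cnj (x2 * y0 - x0 * y2)"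
    "z2 = cnj (x0 * y1 - x1 * y0)"
  have yx: "cnj y0 * x0 + cnj y1 * x1 + cnj y2 * x2 = 0"
    using arg_cong[OF xy, of cnj] by (simp add: mult.commute)
  \<comment> \<open>Lagrange's identity for the norm of a cross product.\<close>
  have "cnj z0 * z0 + cnj z1 * z1 + cnj z2 * z2 =
      (cnj x0 * x0 + cnj x1 * x1 + cnj x2 * x2) * (cnj y0 * y0 + cnj y1 * y1 + cnj y2 * y2) -
      (cnj x0 * y0 + cnj x1 * y1 + cnj x2 * y2) * (cnj y0 * x0 + cnj y1 * x1 + cnj y2 * x2)"
    by (simp add: z algebra_simps)
  then have zz: "cnj z0 * z0 + cnj z1 * z1 + cnj z2 * z2 = 1"
    by (simp add: x y xy)
  \<comment> \<open>Each is a determinant with a repeated column, or the conjugate of one.\<close>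
  have cross: "cnj x0 * z0 + cnj x1 * z1 + cnj x2 * z2 = 0"
    "cnj y0 * z0 + cnj y1 * z1 + cnj y2 * z2 = 0"
    "cnj z0 * x0 + cnj z1 * x1 + cnj z2 * x2 = 0"
    "cnj z0 * y0 + cnj z1 * y1 + cnj z2 * y2 = 0"
    by (simp_all add: z algebra_simps)
  define M where "M = mat 3 3 (\<lambda>(i, j). [[x0, y0, z0], [x1, y1, z1], [x2, y2, z2]] ! i ! j)"
  have M: "M \<in> carrier_mat 3 3" by (simp add: M_def)
  have "(\<Sum>k<3. cnj (M $$ (k, i)) * M $$ (k, j)) = (if i = j then 1 else 0)"
    if "i < 3" "j < 3" for i j
  proof -
    have "i = 0 \<or> i = 1 \<or> i = 2" "j = 0 \<or> j = 1 \<or> j = 2" using that by auto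
    then show ?thesis
      using x y xy yx zz cross
      by (auto simp: M_def numeral_3_eq_3 numeral_2_eq_2)
  qed
  with M have "M \<in> unitary_group 3" by (rule unitary_groupI)
  then show thesis
    by (rule that) (simp_all add: M_def)
qed

text \<open>Orthonormality of the first two columns and Cauchy-Schwarz on their ancillary parts show
  that the block is a contraction. Dividing it by its norm makes the defect of its Gram matrix
  singular, so one extra row completes the two columns.\<close>

lemma unitary_block_rescale:
  assumes M: "M \<in> unitary_group (2 + m)"
    and nonzero: "\<not> (M $$ (0, 0) = 0 \<and> M $$ (1, 0) = 0 \<and> M $$ (0, 1) = 0 \<and> M $$ (1, 1) = 0)"
  obtains t M' where "t \<ge> (1::real)" "M' \<in> unitary_group 3"
    "\<And>i j. i < 2 \<Longrightarrow> j < 2 \<Longrightarrow> M' $$ (i, j) = complex_of_real (sqrt t) * M $$ (i, j)"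
proof -
  define x y where "x k = M $$ (k, 0)" and "y k = M $$ (k, 1)" for k
  define R where "R = {2..<2 + m}"
  \<comment> \<open>\<open>a\<close>, \<open>b\<close> and the \<open>z\<close> below are the
    entries of the Gram matrix of the two block columns.\<close>
  define a b where "a = (cmod (x 0))\<^sup>2 + (cmod (x 1))\<^sup>2" and "b = (cmod (y 0))\<^sup>2 + (cmod (y 1))\<^sup>2"
  define z where "z = cnj (x 0) * y 0 + cnj (x 1) * y 1"
  have split: "(\<Sum>k<2 + m. f k) = f 0 + f 1 + (\<Sum>k\<in>R. f k)" for f :: "nat \<Rightarrow> complex"
  proof -
    have "(\<Sum>k<2 + m. f k) = (\<Sum>k<2. f k) + (\<Sum>k\<in>R. f k)"
      unfolding R_def lessThan_atLeast0 by (rule sum.atLeastLessThan_concat[symmetric]) auto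
    then show ?thesis by (simp add: numeral_2_eq_2)
  qed
  have sq: "cnj w * w = complex_of_real ((cmod w)\<^sup>2)" for w
    using complex_norm_square[of w] by (simp add: mult.commute)
  have "complex_of_real (a + (\<Sum>k\<in>R. (cmod (x k))\<^sup>2)) = 1"
    using unitary_column_inner[OF M, of 0 0] unfolding split sq by (simp add: a_def x_def)
  then have a: "a + (\<Sum>k\<in>R. (cmod (x k))\<^sup>2) = 1" by (simp only: of_real_eq_1_iff)
  have "complex_of_real (b + (\<Sum>k\<in>R. (cmod (y k))\<^sup>2)) = 1"
    using unitary_column_inner[OF M, of 1 1] unfolding split sq by (simp add: b_def y_def)
  then have b: "b + (\<Sum>k\<in>R. (cmod (y k))\<^sup>2) = 1" by (simp only: of_real_eq_1_iff)
  have "z + (\<Sum>k\<in>R. cnj (x k) * y k) = 0"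
    using unitary_column_inner[OF M, of 0 1] unfolding split by (simp add: z_def x_def y_def)
  then have "cmod z = cmod (\<Sum>k\<in>R. cnj (x k) * y k)"
    by (metis add_eq_0_iff norm_minus_cancel)
  also have "\<dots> \<le> (\<Sum>k\<in>R. cmod (x k) * cmod (y k))"
    by (rule order_trans[OF norm_sum]) (simp add: norm_mult)
  finally have "(cmod z)\<^sup>2 \<le> (\<Sum>k\<in>R. cmod (x k) * cmod (y k))\<^sup>2"
    by (intro power_mono) auto
  also have "\<dots> \<le> (\<Sum>k\<in>R. (cmod (x k))\<^sup>2) * (\<Sum>k\<in>R. (cmod (y k))\<^sup>2)"
    by (rule Cauchy_Schwarz_ineq_sum)
  also have "(\<Sum>k\<in>R. (cmod (x k))\<^sup>2) = 1 - a" using a by linarith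
  also have "(\<Sum>k\<in>R. (cmod (y k))\<^sup>2) = 1 - b" using b by linarith
  finally have det: "(cmod z)\<^sup>2 \<le> (1 - a) * (1 - b)" .
  have "a \<ge> 0" "b \<ge> 0" by (auto simp: a_def b_def)
  moreover have "a \<le> 1" "b \<le> 1"
    using a b sum_nonneg[of R "\<lambda>k. (cmod (x k))\<^sup>2"] sum_nonneg[of R "\<lambda>k. (cmod (y k))\<^sup>2"] by auto
  moreover have "a + b > 0"
  proof -
    have "a + b \<noteq> 0"
      using nonzero by (auto simp: a_def b_def x_def y_def add_nonneg_eq_0_iff)
    with \<open>a \<ge> 0\<close> \<open>b \<ge> 0\<close> show ?thesis by linarith
  qed
  ultimately obtain t where t: "t \<ge> 1" "t * a \<le> 1" "t * b \<le> 1"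
    "(t * cmod z)\<^sup>2 = (1 - t * a) * (1 - t * b)"
    using gram_rescale[of a b "cmod z"] det by blast
  \<comment> \<open>The Gram matrix of the new row \<open>u\<close>, \<open>v\<close> must be the
    identity minus \<open>t\<close> times that of the block, hence the sign.\<close>
  have "(cmod (- (of_real t * z)))\<^sup>2 = (1 - t * a) * (1 - t * b)"
    using t by (simp add: norm_mult)
  then obtain u v where uv: "cnj u * u = of_real (1 - t * a)" "cnj v * v = of_real (1 - t * b)"
    "cnj u * v = - (of_real t * z)"
    using rank_one_gram[of "1 - t * a" "1 - t * b" "- (of_real t * z)"] t by auto
  let ?s = "complex_of_real (sqrt t)"
  have s: "?s * (?s * w) = of_real t * w" for w
    using t(1) by (simp flip: of_real_mult mult.assoc)
  have scale: "cnj (?s * p) * (?s * q) = of_real t * (cnj p * q)" for p q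
    using s[of "cnj p * q"] by (simp add: mult_ac)
  obtain M' where M': "M' \<in> unitary_group 3" "M' $$ (0, 0) = ?s * x 0" "M' $$ (1, 0) = ?s * x 1"
    "M' $$ (0, 1) = ?s * y 0" "M' $$ (1, 1) = ?s * y 1"
  proof (rule unitary_3_from_columns)
    show "cnj (?s * x 0) * (?s * x 0) + cnj (?s * x 1) * (?s * x 1) + cnj u * u = 1"
      unfolding scale uv unfolding sq by (simp add: a_def algebra_simps)
    show "cnj (?s * y 0) * (?s * y 0) + cnj (?s * y 1) * (?s * y 1) + cnj v * v = 1"
      unfolding scale uv unfolding sq by (simp add: b_def algebra_simps)
    show "cnj (?s * x 0) * (?s * y 0) + cnj (?s * x 1) * (?s * y 1) + cnj u * v = 0"
      unfolding scale uv by (simp add: z_def algebra_simps)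
  qed
  show thesis
    by (rule that[OF t(1) M'(1)]) (use M' in \<open>auto simp: x_def y_def dest!: less_2_cases\<close>)
qed

section \<open>Comparison of several ancillary modes with a single one\<close>

theorem mainTheorem4:
  fixes A B C :: complex and \<phi> :: fock_vec and m :: nat
  assumes "\<phi> = (\<lambda>n. A * ket [2, 0] n + B * ket [1, 1] n + C * ket [0, 2] n)"
    and "fock_inner \<phi> \<phi> = 1"
    and "m \<ge> 1"
  shows "max_success_prob m \<phi> \<le> max_success_prob 1 \<phi>"
  unfolding max_success_prob_def
\<comment> \<open>Each admissible transformation on \<open>2 + m\<close> modes is matched by one on
  three modes that succeeds at least as often. If there is none, the left supremum is minus infinity
  in \<open>ereal\<close>.\<close>
proof (rule Sup_mono)
  have prob: "success_prob m' U = (cmod c)\<^sup>2" if "postselected m' U = (\<lambda>n. c * \<phi> n)" for m' U c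
  proof -
    have "fock_inner (\<lambda>n. c * \<phi> n) (\<lambda>n. c * \<phi> n) = (cnj c * c) * fock_inner \<phi> \<phi>"
      unfolding fock_inner_def infsum_cmult_right'[symmetric] by (simp add: mult_ac)
    then have "fock_inner (\<lambda>n. c * \<phi> n) (\<lambda>n. c * \<phi> n) = of_real ((cmod c)\<^sup>2)"
      using assms(2) complex_norm_square[of c] by (simp add: mult.commute)
    with that show ?thesis by (simp add: success_prob_def)
  qed
  fix p
  assume "p \<in> {ereal (success_prob m U) | M U. M \<in> unitary_group (2 + m) \<and> lop (2 + m) M U \<and>
      (\<exists>c. c \<noteq> 0 \<and> postselected m U = (\<lambda>n. c * \<phi> n))}"
  then obtain M U c where p: "p = ereal (success_prob m U)" and M: "M \<in> unitary_group (2 + m)"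
    and U: "lop (2 + m) M U" and c: "c \<noteq> 0" "postselected m U = (\<lambda>n. c * \<phi> n)"
    by blast
  \<comment> \<open>A zero block would make the post-selected state vanish, although it is a nonzero
    multiple of a nonzero \<phi>.\<close>
  have "\<phi> \<noteq> (\<lambda>_. 0)"
    using assms(2) by (auto simp: fock_inner_def)
  then have "\<not> (M $$ (0, 0) = 0 \<and> M $$ (1, 0) = 0 \<and> M $$ (0, 1) = 0 \<and> M $$ (1, 1) = 0)"
    using c postselected_lop[OF U] by (auto simp: fun_eq_iff)
  then obtain t M' where t: "t \<ge> 1" and M': "M' \<in> unitary_group 3"
    and block: "\<And>i j. i < 2 \<Longrightarrow> j < 2 \<Longrightarrow> M' $$ (i, j) = complex_of_real (sqrt t) * M $$ (i, j)"
    using unitary_block_rescale[OF M] by metis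
  define U' where "U' = second_quantize 3 M'"
  have U': "lop (2 + 1) M' U'"
    using lop_second_quantize[OF M'] by (simp add: U'_def)
  have "complex_of_real (sqrt t) * complex_of_real (sqrt t) = of_real t"
    using t by (simp flip: of_real_mult)
  then have "(complex_of_real (sqrt t) * v) * (complex_of_real (sqrt t) * w) = of_real t * (v * w)"
    for v w
    by (metis mult.assoc mult.left_commute)
  \<comment> \<open>Every amplitude is built from products of two block entries, so the root of
    \<open>t\<close> enters twice.\<close>
  then have "M' $$ (i, j) * M' $$ (k, l) = of_real t * (M $$ (i, j) * M $$ (k, l))"
    if "i < 2" "j < 2" "k < 2" "l < 2" for i j k l
    by (simp only: block that)
  then have "postselected 1 U' = (\<lambda>n. of_real t * postselected m U n)"
    unfolding postselected_lop[OF U'] postselected_lop[OF U] by (simp add: algebra_simps)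
  then have c': "postselected 1 U' = (\<lambda>n. (of_real t * c) * \<phi> n)"
    by (simp add: c(2) mult.assoc)
  \<comment> \<open>The amplitude grows by the factor \<open>t\<close>, the probability by its
    square.\<close>
  have "1 * (cmod c)\<^sup>2 \<le> t\<^sup>2 * (cmod c)\<^sup>2"
    using t by (intro mult_right_mono) (auto simp: one_le_power)
  moreover have "success_prob 1 U' = t\<^sup>2 * (cmod c)\<^sup>2"
    unfolding prob[OF c'] by (simp add: norm_mult power_mult_distrib)
  ultimately have "p \<le> ereal (success_prob 1 U')"
    by (simp add: p prob[OF c(2)])
  moreover have "of_real t * c \<noteq> 0" using t c(1) by simp
  ultimately show "\<exists>q\<in>{ereal (success_prob 1 U) | M U. M \<in> unitary_group (2 + 1) \<and> lop (2 + 1) M U \<and>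
      (\<exists>c. c \<noteq> 0 \<and> postselected 1 U = (\<lambda>n. c * \<phi> n))}. p \<le> q"
    using M' U' c'
    by (intro bexI[of _ "ereal (success_prob 1 U')"] CollectI exI[of _ M'] exI[of _ U'] conjI
        exI[of _ "of_real t * c"]) simp_all
qed

end
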